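(* Let $Q\in\mathbb{R}^{n\times n}$ be symmetric positive definite, $b\in\mathbb{R}^n$, $f(x)=\frac12\langle x,Qx\rangle-\langle b,x\rangle$, and let $x^*$ be the unique minimizer of $f$. Let $S\in\mathbb{R}^{n\times n}$ be symmetric positive semidefinite, let $x^0\in\mathbb{R}^n$, and let $R>0$ be a constant with $$R\ge \sup\{\|x-x^*\|_S : x\in\mathbb{R}^n,\ f(x)\le f(x^0)\}.$$ Let $\{x^{\ell,k_\ell}\}$ be the sequence generated from $x^0$ by the accelerated method with restarting strategy (as defined in the context), indexed as $x^t:=x^{\ell,k_\ell}$ with $t=\sum_{j=0}^{\ell-1}\widetilde K_j+k_\ell$, $0\le k_\ell\le\widetilde K_\ell$. Then $$f(x^t)-f(x^* )\le\frac{2R^2(\log_2 t)^2}{t^2},\qquad\text{for all } t\ge 2.$$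
   Context: For a symmetric positive semidefinite matrix $A$, $\|x\|_A:=\sqrt{\langle x,Ax\rangle}$. Since $Q$ is positive definite, the level set $\{x: f(x)\le f(x^0)\}$ is bounded, so such an $R$ exists. Accelerated method with restarting strategy. Input: $x^0=y^1\in\mathbb{R}^n$, $\alpha_0=0$, $\alpha_1=1$, a symmetric positive semidefinite matrix $S$, $\ell=0$, a user-specified $K_0\ge2$, and $K_{\mathrm{re}}=0$. For iterations $t=1,2,\dots$ (raw iteration counter) perform: (1) $x^t=\operatorname{argmin}_{x\in\mathbb{R}^n}\left\{\frac12\langle x,Qx\rangle-\langle b,x\rangle+\frac12\|x-y^t\|_S^2\right\}$. (2) If $t>K_{\mathrm{re}}+K_\ell$ and $\langle Qy^t-b,\,x^t-x^{t-1}\rangle\ge0$, then a restart takes place at iteration $t$: set $K_{\mathrm{re}}=t$, $K_{\ell+1}=2K_\ell$, then increase $\ell$ by $1$, set $\alpha_{t+1}=1$, $\alpha_t=0$, $y^{t+1}=x^{t-1}$, and overwrite $x^t=x^{t-1}$. (3) Otherwise set $\alpha_{t+1}=\frac{1+\sqrt{1+4\alpha_t^2}}{2}$ and $y^{t+1}=\left(1+\frac{\alpha_t-1}{\alpha_{t+1}}\right)x^t-\frac{\alpha_t-1}{\alpha_{t+1}}x^{t-1}$. Indexing by stages. Let $\tau_0=0$ and let $\tau_\ell$ ($\ell\ge1$) be the raw iteration at which the $\ell$-th restart takes place. Let $\widetilde K_\ell=\tau_{\ell+1}-\tau_\ell-1$ be the number of iterations taken between the $\ell$-th and the $(\ell+1)$-th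 restart, excluding the iteration at which the restart takes place (the start of the method counts as the $0$-th restart; $\widetilde K_\ell=\infty$ if there is no $(\ell+1)$-th restart). For $0\le k_\ell\le\widetilde K_\ell$ ($k_\ell$ a finite integer), $x^{\ell,k_\ell}$ denotes the (final, i.e. possibly overwritten) iterate at raw iteration $\tau_\ell+k_\ell$. Thus $x^{0,0}=x^0$ and $x^{\ell,0}=x^{\ell-1,\widetilde K_{\ell-1}}$ for each $\ell\ge1$ for which the $\ell$-th restart occurs. In the claim, $x^t$ refers to the counter $t=\sum_{j=0}^{\ell-1}\widetilde K_j+k_\ell$, which does not count the restart iterations; this is well defined because $x^{\ell,0}=x^{\ell-1,\widetilde K_{\ell-1}}$. *)

theory Defs
  imports "HOL-Analysis.Analysis" "HOL-Library.Extended_Nat"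
begin

definition pos_semidef_matrix :: "real^'n^'n \<Rightarrow> bool" where
  "pos_semidef_matrix A \<longleftrightarrow> transpose A = A \<and> (\<forall>x. x \<bullet> (A *v x) \<ge> 0)"

definition pos_def_matrix :: "real^'n^'n \<Rightarrow> bool" where
  "pos_def_matrix A \<longleftrightarrow> transpose A = A \<and> (\<forall>x. x \<noteq> 0 \<longrightarrow> x \<bullet> (A *v x) > 0)"

definition matrix_seminorm :: "real^'n^'n \<Rightarrow> real^'n \<Rightarrow> real" where
  "matrix_seminorm A x = sqrt (x \<bullet> (A *v x))"

definition quad_obj :: "real^'n^'n \<Rightarrow> real^'n \<Rightarrow> real^'n \<Rightarrow> real" where
  "quad_obj Q b x = 1/2 * (x \<bullet> (Q *v x)) - b \<bullet> x"

text \<open>The minimiser below exists and is unique whenever \<open>Q\<close> is positive definite and \<open>S\<close> is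
  positive semidefinite.\<close>

definition prox_step :: "real^'n^'n \<Rightarrow> real^'n \<Rightarrow> real^'n^'n \<Rightarrow> real^'n \<Rightarrow> real^'n" where
  "prox_step Q b S y =
     (ARG_MIN (\<lambda>x. quad_obj Q b x + 1/2 * (matrix_seminorm S (x - y))\<^sup>2) x. True)"

text \<open>The state after raw iteration \<open>t\<close> stores \<open>x\<^sup>t\<close> (after a possible overwriting), \<open>y\<^sup>t\<^sup>+\<^sup>1\<close>,
  \<open>\<alpha>\<^sub>t\<^sub>+\<^sub>1\<close>, the current \<open>K\<^sub>r\<^sub>e\<close>, and the current window length \<open>K\<^sub>\<ell>\<close>. The counter \<open>\<ell>\<close> itself only
  selects \<open>K\<^sub>\<ell>\<close>, and the value \<open>\<alpha>\<^sub>t = 0\<close> set at a restart is never read afterwards.\<close>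

record 'v accel_state =
  iter :: 'v
  extrap :: 'v
  alpha :: real
  last_restart :: nat
  window :: nat

definition restart_test ::
    "real^'n^'n \<Rightarrow> real^'n \<Rightarrow> real^'n^'n \<Rightarrow> nat \<Rightarrow> (real^'n) accel_state \<Rightarrow> bool" where
  "restart_test Q b S t s \<longleftrightarrow>
     t > last_restart s + window s \<and>
     (Q *v extrap s - b) \<bullet> (prox_step Q b S (extrap s) - iter s) \<ge> 0"

definition accel_step ::
    "real^'n^'n \<Rightarrow> real^'n \<Rightarrow> real^'n^'n \<Rightarrow> nat \<Rightarrow> (real^'n) accel_state \<Rightarrow> (real^'n) accel_state" where
  "accel_step Q b S t s =
     (if restart_test Q b S t s
      then \<lparr>iter = iter s, extrap = iter s, alpha = 1, last_restart = t, window = 2 * window s\<rparr>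
      else
        (let x = prox_step Q b S (extrap s);
             a = (1 + sqrt (1 + 4 * (alpha s)\<^sup>2)) / 2;
             c = (alpha s - 1) / a
         in \<lparr>iter = x, extrap = (1 + c) *\<^sub>R x - c *\<^sub>R iter s, alpha = a,
             last_restart = last_restart s, window = window s\<rparr>))"

primrec accel_run ::
    "real^'n^'n \<Rightarrow> real^'n \<Rightarrow> real^'n^'n \<Rightarrow> real^'n \<Rightarrow> nat \<Rightarrow> nat \<Rightarrow> (real^'n) accel_state" where
  "accel_run Q b S x0 K0 0 =
     \<lparr>iter = x0, extrap = x0, alpha = 1, last_restart = 0, window = K0\<rparr>"
| "accel_run Q b S x0 K0 (Suc t) = accel_step Q b S (Suc t) (accel_run Q b S x0 K0 t)"

definition restart_at ::
    "real^'n^'n \<Rightarrow> real^'n \<Rightarrow> real^'n^'n \<Rightarrow> real^'n \<Rightarrow> nat \<Rightarrow> nat \<Rightarrow> bool" where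
  "restart_at Q b S x0 K0 t \<longleftrightarrow> t \<ge> 1 \<and> restart_test Q b S t (accel_run Q b S x0 K0 (t - 1))"

text \<open>In the next two definitions \<open>P t\<close> says that a restart takes place at raw iteration \<open>t\<close>.
  \<open>restart_time P l\<close> is \<open>\<tau>\<^sub>l\<close>, and it is \<open>\<infinity>\<close> if there is no \<open>l\<close>-th restart, because the infimum of
  the empty set of extended naturals is \<open>\<infinity>\<close>. As \<open>\<infinity> - n = \<infinity>\<close>, the length of the last stage is
  \<open>\<infinity>\<close>.\<close>

primrec restart_time :: "(nat \<Rightarrow> bool) \<Rightarrow> nat \<Rightarrow> enat" where
  "restart_time P 0 = 0"
| "restart_time P (Suc l) = Inf {enat t | t. enat t > restart_time P l \<and> P t}"

definition stage_length :: "(nat \<Rightarrow> bool) \<Rightarrow> nat \<Rightarrow> enat" where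
  "stage_length P l = restart_time P (Suc l) - restart_time P l - 1"

text \<open>\<open>stage_index P l k\<close>: stage \<open>l\<close> is entered and \<open>0 \<le> k \<le> K\<close> for its length \<open>K\<close>, so that
  \<open>x\<^sup>l\<^sup>,\<^sup>k\<close> is defined.\<close>

definition stage_index :: "(nat \<Rightarrow> bool) \<Rightarrow> nat \<Rightarrow> nat \<Rightarrow> bool" where
  "stage_index P l k \<longleftrightarrow> restart_time P l \<noteq> \<infinity> \<and> enat k \<le> stage_length P l"

definition stage_iterate ::
    "real^'n^'n \<Rightarrow> real^'n \<Rightarrow> real^'n^'n \<Rightarrow> real^'n \<Rightarrow> nat \<Rightarrow> nat \<Rightarrow> nat \<Rightarrow> real^'n" where
  "stage_iterate Q b S x0 K0 l k =
     iter (accel_run Q b S x0 K0 (the_enat (restart_time (restart_at Q b S x0 K0) l) + k))"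

text \<open>The sequence indexed by the counter that skips the restart iterations. The description is
  proper for every \<open>t\<close>, see \<open>restarted_seq_well_defined\<close> below.\<close>

definition restarted_seq ::
    "real^'n^'n \<Rightarrow> real^'n \<Rightarrow> real^'n^'n \<Rightarrow> real^'n \<Rightarrow> nat \<Rightarrow> nat \<Rightarrow> real^'n" where
  "restarted_seq Q b S x0 K0 t =
     (THE x. \<exists>l k. stage_index (restart_at Q b S x0 K0) l k \<and>
        enat t = (\<Sum>j<l. stage_length (restart_at Q b S x0 K0) j) + enat k \<and>
        x = stage_iterate Q b S x0 K0 l k)"

primrec nonrestart_count :: "(nat \<Rightarrow> bool) \<Rightarrow> nat \<Rightarrow> nat" where
  "nonrestart_count P 0 = 0"
| "nonrestart_count P (Suc r) = nonrestart_count P r + (if P (Suc r) then 0 else 1)"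

lemma restart_time_SucD:
  assumes "restart_time P (Suc l) = enat a'"
  obtains a where "restart_time P l = enat a" "a < a'" "P a'"
    "\<And>s. a < s \<Longrightarrow> s < a' \<Longrightarrow> \<not> P s"
proof -
  let ?A = "{enat t | t. enat t > restart_time P l \<and> P t}"
  have I: "Inf ?A = enat a'" using assms by simp
  have "?A \<noteq> {}" using I by (metis Inf_empty enat.distinct(2) top_enat_def)
  hence "Inf ?A \<in> ?A" by (metis (no_types, lifting) Inf_enat_def LeastI_ex ex_in_conv)
  hence mem: "enat a' > restart_time P l" "P a'" using I by auto
  then obtain a where a: "restart_time P l = enat a" "a < a'"
    by (cases "restart_time P l") auto
  have "\<not> P s" if "a < s" "s < a'" for s
  proof
    assume "P s"
    hence "enat s \<in> ?A" using that a by auto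
    hence "Inf ?A \<le> enat s" by (rule Inf_lower)
    thus False using I that by simp
  qed
  thus thesis using that a mem by blast
qed

lemma restart_time_SucI:
  assumes "restart_time P l = enat a" "a < a'" "P a'"
    "\<And>s. a < s \<Longrightarrow> s < a' \<Longrightarrow> \<not> P s"
  shows "restart_time P (Suc l) = enat a'"
proof -
  let ?A = "{enat t | t. enat t > restart_time P l \<and> P t}"
  have "Inf ?A = enat a'"
  proof (rule antisym)
    show "Inf ?A \<le> enat a'" using assms by (intro Inf_lower) auto
    show "enat a' \<le> Inf ?A"
    proof (rule Inf_greatest)
      fix x assume "x \<in> ?A"
      then obtain t where t: "x = enat t" "a < t" "P t" using assms(1) by auto
      with assms(4)[of t] show "enat a' \<le> x" by (cases "t < a'") auto
    qed
  qed
  thus ?thesis by simp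
qed

lemma le_stage_length_iff:
  assumes a: "restart_time P l = enat a"
  shows "enat k \<le> stage_length P l \<longleftrightarrow> (\<forall>s. a < s \<and> s \<le> a + k \<longrightarrow> \<not> P s)"
proof (cases "restart_time P (Suc l)")
  case (enat a')
  from restart_time_SucD[OF this] a
  have *: "a < a'" "P a'" "\<And>s. a < s \<Longrightarrow> s < a' \<Longrightarrow> \<not> P s" by auto
  have "stage_length P l = enat (a' - a - 1)"
    unfolding stage_length_def enat a by (simp add: one_enat_def)
  have "enat k \<le> stage_length P l \<longleftrightarrow> a + k < a'"
    using * by (auto simp: \<open>stage_length P l = enat (a' - a - 1)\<close>)
  thus ?thesis using * by (metis add_leE le_add1 le_neq_implies_less linorder_not_less order_le_less_trans)
next
  case infinity
  have "\<not> P s" if "a < s" for s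
  proof
    assume "P s"
    define m where "m = (LEAST s. a < s \<and> P s)"
    have "a < m \<and> P m" unfolding m_def using \<open>P s\<close> that by (intro LeastI) auto
    moreover have "\<not> P s'" if "a < s'" "s' < m" for s'
      using that not_less_Least unfolding m_def by blast
    ultimately have "restart_time P (Suc l) = enat m"
      using restart_time_SucI[OF a] by blast
    thus False using infinity by simp
  qed
  thus ?thesis unfolding stage_length_def infinity a by (simp add: one_enat_def)
qed

lemma nonrestart_count_add:
  "(\<forall>s. a < s \<and> s \<le> a + k \<longrightarrow> \<not> P s) \<Longrightarrow> nonrestart_count P (a + k) = nonrestart_count P a + k"
  by (induction k) auto

lemma sum_stage_length:
  "restart_time P l = enat a \<Longrightarrow> (\<Sum>j<l. stage_length P j) = enat (nonrestart_count P a)"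
proof (induction l arbitrary: a)
  case 0
  thus ?case by (simp add: zero_enat_def)
next
  case (Suc l a')
  from restart_time_SucD[OF Suc.prems] obtain a where
    a: "restart_time P l = enat a" "a < a'" "P a'" "\<And>s. a < s \<Longrightarrow> s < a' \<Longrightarrow> \<not> P s" by metis
  define d where "d = a' - a - 1"
  have a': "a' = Suc (a + d)" using a(2) by (simp add: d_def)
  have "nonrestart_count P (a + d) = nonrestart_count P a + d"
    using a(4) a' by (intro nonrestart_count_add) auto
  moreover have "stage_length P l = enat d"
    using Suc.prems a(1) unfolding stage_length_def d_def by (simp add: one_enat_def del: restart_time.simps)
  ultimately show ?case using Suc.IH[OF a(1)] a(3) a' by simp
qed

lemma stage_index_exists:
  "\<exists>l k. stage_index P l k \<and> r = the_enat (restart_time P l) + k"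
proof (induction r)
  case 0
  have "stage_index P 0 0" by (simp add: stage_index_def flip: zero_enat_def)
  thus ?case by (intro exI[of _ 0]) (simp add: zero_enat_def)
next
  case (Suc r)
  then obtain l k where lk: "stage_index P l k" "r = the_enat (restart_time P l) + k" by blast
  then obtain a where a: "restart_time P l = enat a" by (auto simp: stage_index_def)
  have r: "r = a + k" using lk a by simp
  have np: "\<forall>s. a < s \<and> s \<le> a + k \<longrightarrow> \<not> P s"
    using lk(1) le_stage_length_iff[OF a] by (simp add: stage_index_def)
  show ?case
  proof (cases "P (Suc r)")
    case True
    have "restart_time P (Suc l) = enat (Suc r)"
      using np True r by (intro restart_time_SucI[OF a]) auto
    thus ?thesis
      by (intro exI[of _ "Suc l"] exI[of _ 0])
        (simp add: stage_index_def del: restart_time.simps flip: zero_enat_def)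
  next
    case False
    hence "enat (Suc k) \<le> stage_length P l"
      unfolding le_stage_length_iff[OF a] using np r by (auto simp: le_Suc_eq)
    thus ?thesis using a r by (intro exI[of _ l] exI[of _ "Suc k"]) (auto simp: stage_index_def)
  qed
qed

lemma stage_index_count:
  assumes "stage_index P l k"
  shows "(\<Sum>j<l. stage_length P j) + enat k =
    enat (nonrestart_count P (the_enat (restart_time P l) + k))"
proof -
  from assms obtain a where a: "restart_time P l = enat a" by (auto simp: stage_index_def)
  have "nonrestart_count P (a + k) = nonrestart_count P a + k"
    using assms le_stage_length_iff[OF a] by (intro nonrestart_count_add) (simp add: stage_index_def)
  thus ?thesis using sum_stage_length[OF a] a by simp
qed

lemma iter_restart:
  "restart_at Q b S x0 K0 (Suc r) \<Longrightarrow>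
    iter (accel_run Q b S x0 K0 (Suc r)) = iter (accel_run Q b S x0 K0 r)"
  by (simp add: restart_at_def accel_step_def)

lemma window_ge: "window (accel_run Q b S x0 K0 r) \<ge> K0"
  by (induction r) (auto simp: accel_step_def Let_def)

lemma restart_not_consecutive:
  assumes "K0 \<ge> 1" "restart_at Q b S x0 K0 (Suc r)"
  shows "\<not> restart_at Q b S x0 K0 (Suc (Suc r))"
  using assms window_ge[of K0 Q b S x0 r]
  by (auto simp: restart_at_def accel_step_def restart_test_def)

lemma nonrestart_count_mono: "r \<le> r' \<Longrightarrow> nonrestart_count P r \<le> nonrestart_count P r'"
  by (rule lift_Suc_mono_le) auto

lemma iter_eq_of_count_eq:
  assumes "r \<le> r'"
    "nonrestart_count (restart_at Q b S x0 K0) r = nonrestart_count (restart_at Q b S x0 K0) r'"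
  shows "iter (accel_run Q b S x0 K0 r) = iter (accel_run Q b S x0 K0 r')"
  using assms
proof (induction r' rule: dec_induct)
  case (step m)
  let ?P = "restart_at Q b S x0 K0"
  have "nonrestart_count ?P r \<le> nonrestart_count ?P m"
    using step.hyps by (intro nonrestart_count_mono) auto
  hence "?P (Suc m)" "nonrestart_count ?P r = nonrestart_count ?P m"
    using step.prems by (auto split: if_splits)
  thus ?case using step.IH iter_restart by metis
qed simp

lemma nonrestart_count_surj:
  assumes "K0 \<ge> 1"
  shows "\<exists>r. nonrestart_count (restart_at Q b S x0 K0) r = t"
proof (induction t)
  case 0
  show ?case by (intro exI[of _ 0]) simp
next
  case (Suc t)
  let ?P = "restart_at Q b S x0 K0"
  obtain r where r: "nonrestart_count ?P r = t" using Suc by blast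
  show ?case
  proof (cases "?P (Suc r)")
    case True
    with restart_not_consecutive[OF assms True] r
    have "nonrestart_count ?P (Suc (Suc r)) = Suc t" by simp
    thus ?thesis by blast
  next
    case False
    hence "nonrestart_count ?P (Suc r) = Suc t" using r by simp
    thus ?thesis by blast
  qed
qed

lemma restarted_seq_well_defined:
  assumes "K0 \<ge> 1"
  shows "\<exists>!x. \<exists>l k. stage_index (restart_at Q b S x0 K0) l k \<and>
        enat t = (\<Sum>j<l. stage_length (restart_at Q b S x0 K0) j) + enat k \<and>
        x = stage_iterate Q b S x0 K0 l k"
proof -
  let ?P = "restart_at Q b S x0 K0"
  obtain r where r: "nonrestart_count ?P r = t" using nonrestart_count_surj[OF assms] by blast
  obtain l k where lk: "stage_index ?P l k" "r = the_enat (restart_time ?P l) + k"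
    using stage_index_exists by blast
  have 1: "enat t = (\<Sum>j<l. stage_length ?P j) + enat k"
    using stage_index_count[OF lk(1)] r lk(2) by simp
  have 2: "stage_iterate Q b S x0 K0 l' k' = iter (accel_run Q b S x0 K0 r)"
    if "stage_index ?P l' k'" "enat t = (\<Sum>j<l'. stage_length ?P j) + enat k'" for l' k'
  proof -
    have "nonrestart_count ?P (the_enat (restart_time ?P l') + k') = nonrestart_count ?P r"
      using stage_index_count[OF that(1)] that(2) r by simp
    thus ?thesis unfolding stage_iterate_def
      using iter_eq_of_count_eq by (metis nle_le)
  qed
  show ?thesis
  proof (rule ex1I[of _ "iter (accel_run Q b S x0 K0 r)"])
    show "\<exists>l k. stage_index ?P l k \<and> enat t = (\<Sum>j<l. stage_length ?P j) + enat k \<and>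
        iter (accel_run Q b S x0 K0 r) = stage_iterate Q b S x0 K0 l k"
      using lk(1) 1 2[OF lk(1) 1] by metis
  next
    fix x assume "\<exists>l k. stage_index ?P l k \<and> enat t = (\<Sum>j<l. stage_length ?P j) + enat k \<and>
        x = stage_iterate Q b S x0 K0 l k"
    thus "x = iter (accel_run Q b S x0 K0 r)" using 2 by metis
  qed
qed

lemma restarted_seq_eq:
  assumes "K0 \<ge> 1" "stage_index (restart_at Q b S x0 K0) l k"
    "enat t = (\<Sum>j<l. stage_length (restart_at Q b S x0 K0) j) + enat k"
  shows "restarted_seq Q b S x0 K0 t = stage_iterate Q b S x0 K0 l k"
  unfolding restarted_seq_def
  using assms by (intro the1_equality[OF restarted_seq_well_defined]) auto

lemma level_set_nonempty: "x0 \<in> {x. quad_obj Q b x \<le> quad_obj Q b x0}"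
  by simp

lemma pos_def_matrix_coercive:
  fixes Q :: "real^'n^'n"
  assumes "pos_def_matrix Q"
  obtains c where "c > 0" "\<And>x. c * (norm x)\<^sup>2 \<le> x \<bullet> (Q *v x)"
proof -
  have ne: "sphere (0::real^'n) 1 \<noteq> {}" by (simp add: sphere_eq_empty)
  have cont: "continuous_on (sphere 0 1) (\<lambda>x. x \<bullet> (Q *v x))"
    by (intro continuous_intros matrix_vector_mult_linear_continuous_on)
  obtain u where u: "u \<in> sphere 0 1" "\<And>x. x \<in> sphere 0 1 \<Longrightarrow> u \<bullet> (Q *v u) \<le> x \<bullet> (Q *v x)"
    using continuous_attains_inf[OF compact_sphere ne cont] by auto
  have "u \<noteq> 0" using u(1) by auto
  hence pos: "u \<bullet> (Q *v u) > 0" using assms by (simp add: pos_def_matrix_def)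
  have "u \<bullet> (Q *v u) * (norm x)\<^sup>2 \<le> x \<bullet> (Q *v x)" for x
  proof (cases "x = 0")
    case False
    define v where "v = x /\<^sub>R norm x"
    have v: "v \<in> sphere 0 1" and x: "x = norm x *\<^sub>R v" using False by (auto simp: v_def)
    have "x \<bullet> (Q *v x) = (norm x)\<^sup>2 * (v \<bullet> (Q *v v))"
      by (subst (1 2) x) (simp add: matrix_vector_mult_scaleR power2_eq_square)
    thus ?thesis using u(2)[OF v] by (simp add: mult.commute mult_right_mono)
  qed simp
  with pos show thesis using that by blast
qed

lemma level_set_bounded:
  assumes "pos_def_matrix Q"
  shows "bounded {x. quad_obj Q b x \<le> a}"
proof -
  obtain c where c: "c > 0" "\<And>x. c * (norm x)\<^sup>2 \<le> x \<bullet> (Q *v x)"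
    using pos_def_matrix_coercive[OF assms] by blast
  have "norm x \<le> 1 + 2 * (norm b + \<bar>a\<bar>) / c" if "quad_obj Q b x \<le> a" for x
  proof (cases "norm x \<le> 1")
    case True
    thus ?thesis using c(1) by (smt (verit) divide_nonneg_pos norm_ge_zero)
  next
    case False
    have "b \<bullet> x \<le> norm b * norm x" by (rule norm_cauchy_schwarz)
    moreover have "a \<le> \<bar>a\<bar> * norm x" using False by (smt (verit) mult_le_cancel_left1)
    ultimately have "c * (norm x)\<^sup>2 \<le> 2 * (norm b + \<bar>a\<bar>) * norm x"
      using that c(2)[of x] by (simp add: quad_obj_def algebra_simps)
    hence "(c * norm x) * norm x \<le> (2 * (norm b + \<bar>a\<bar>)) * norm x"
      by (simp only: power2_eq_square mult.assoc)
    moreover have "norm x > 0" using False by linarith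
    ultimately have "c * norm x \<le> 2 * (norm b + \<bar>a\<bar>)"
      by (rule mult_right_le_imp_le)
    thus ?thesis using c(1) by (simp add: field_simps)
  qed
  thus ?thesis unfolding bounded_iff by blast
qed

lemma matrix_seminorm_level_bdd:
  assumes "pos_def_matrix Q"
  shows "bdd_above ((\<lambda>x. matrix_seminorm S (x - z)) ` {x. quad_obj Q b x \<le> a})"
proof -
  let ?L = "{x. quad_obj Q b x \<le> a}"
  have "continuous_on (closure ?L) (\<lambda>x. matrix_seminorm S (x - z))"
    unfolding matrix_seminorm_def matrix_vector_mult_diff_distrib
    by (intro continuous_intros matrix_vector_mult_linear_continuous_on)
  hence "compact ((\<lambda>x. matrix_seminorm S (x - z)) ` closure ?L)"
    using level_set_bounded[OF assms] by (intro compact_continuous_image) auto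
  thus ?thesis
    by (meson bdd_above_mono bounded_imp_bdd_above closure_subset compact_imp_bounded image_mono)
qed

end

theory Submission
  imports Defs
begin

text \<open>Two quantities decrease along the steps of a stage: \<open>f(x) + \<parallel>y - x\<parallel>\<^sub>S\<^sup>2 / 2\<close>, because the
  extrapolation factor is at most 1, and the usual energy of accelerated methods. The first keeps
  every iterate in the level set of the starting point of its stage, so each stage starts within
  \<open>S\<close>-distance \<open>R\<close> of \<open>x\<^sup>*\<close>, and the second then gives \<open>f(x) - f(x\<^sup>*) \<le> 2 R\<^sup>2 / (k + 1)\<^sup>2\<close> after
  \<open>k\<close> steps of the stage. As \<open>f\<close> does not increase from one stage start to the next, this bound
  persists, so the longest stage so far may be used. Stage \<open>j\<close> has at least \<open>2\<^sup>j K\<^sub>0 \<ge> 2\<^sup>j\<^sup>+\<^sup>1\<close> steps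
  if it is completed, hence there are at most \<open>log\<^sub>2 t\<close> stages and the longest one has about
  \<open>t / log\<^sub>2 t\<close> steps; a current stage of fewer than two steps is not counted.\<close>

section \<open>Quadratic forms, their seminorms and the objective\<close>

lemma symmetric_matrix_inner:
  fixes A :: "real^'n^'n"
  assumes "transpose A = A"
  shows "x \<bullet> (A *v y) = y \<bullet> (A *v x)"
  by (metis assms dot_lmul_matrix inner_commute transpose_matrix_vector)

lemma quadratic_form_add:
  fixes A :: "real^'n^'n"
  assumes "transpose A = A"
  shows "(x + y) \<bullet> (A *v (x + y)) = x \<bullet> (A *v x) + 2 * (y \<bullet> (A *v x)) + y \<bullet> (A *v y)"
  using symmetric_matrix_inner[OF assms, of x y]
  by (simp add: matrix_vector_right_distrib inner_simps)

lemma quadratic_form_scaleR: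
  fixes A :: "real^'n^'n"
  shows "(c *\<^sub>R x) \<bullet> (A *v (c *\<^sub>R x)) = c\<^sup>2 * (x \<bullet> (A *v x))"
  by (simp add: matrix_vector_mult_scaleR power2_eq_square)

lemma matrix_seminorm_power2:
  "pos_semidef_matrix A \<Longrightarrow> (matrix_seminorm A x)\<^sup>2 = x \<bullet> (A *v x)"
  by (simp add: matrix_seminorm_def pos_semidef_matrix_def)

lemma matrix_seminorm_nonneg: "pos_semidef_matrix A \<Longrightarrow> matrix_seminorm A x \<ge> 0"
  by (simp add: matrix_seminorm_def pos_semidef_matrix_def)

lemma matrix_seminorm_scaleR: "matrix_seminorm A (c *\<^sub>R x) = \<bar>c\<bar> * matrix_seminorm A x"
  by (simp only: matrix_seminorm_def quadratic_form_scaleR real_sqrt_mult real_sqrt_abs)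

lemma matrix_seminorm_minus_commute: "matrix_seminorm A (x - y) = matrix_seminorm A (y - x)"
  using matrix_seminorm_scaleR[of A "-1" "x - y"] by simp

lemma pos_def_imp_semidef: "pos_def_matrix A \<Longrightarrow> pos_semidef_matrix A"
  unfolding pos_def_matrix_def pos_semidef_matrix_def
  by (metis inner_zero_left less_eq_real_def)

lemma pos_def_matrix_add:
  "pos_def_matrix A \<Longrightarrow> pos_semidef_matrix B \<Longrightarrow> pos_def_matrix (A + B)"
  unfolding pos_def_matrix_def pos_semidef_matrix_def
  by (auto simp: matrix_vector_mult_add_rdistrib inner_add_right add_pos_nonneg transpose_def vec_eq_iff)

text \<open>If two images agree, the difference has vanishing quadratic form; in finite dimension
  injectivity gives surjectivity.\<close>

lemma pos_def_matrix_solvable: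
  fixes A :: "real^'n^'n"
  assumes "pos_def_matrix A"
  obtains x where "A *v x = c"
proof -
  have "inj ((*v) A)"
  proof (rule injI)
    fix x y assume "A *v x = A *v y"
    then have "(x - y) \<bullet> (A *v (x - y)) = 0" by (simp add: matrix_vector_mult_diff_distrib)
    with assms show "x = y" unfolding pos_def_matrix_def by (metis less_irrefl right_minus_eq)
  qed
  then have "surj ((*v) A)"
    by (rule linear_injective_imp_surjective[OF matrix_vector_mul_linear]) simp
  then show thesis using that by (metis surjD)
qed

lemma quad_obj_expansion:
  assumes "transpose Q = Q"
  shows "quad_obj Q b z = quad_obj Q b w + (Q *v w - b) \<bullet> (z - w) + 1/2 * ((z - w) \<bullet> (Q *v (z - w)))"
  using quadratic_form_add[OF assms, of w "z - w"]
  by (simp add: quad_obj_def inner_simps inner_commute algebra_simps)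

text \<open>The tangent plane at the convex combination lies below the objective, and averaging it
  cancels the gradient term.\<close>

lemma quad_obj_convex:
  assumes "pos_semidef_matrix Q" "0 \<le> u" "u \<le> 1"
  shows "quad_obj Q b ((1 - u) *\<^sub>R x + u *\<^sub>R z) \<le> (1 - u) * quad_obj Q b x + u * quad_obj Q b z"
proof -
  define w where "w = (1 - u) *\<^sub>R x + u *\<^sub>R z"
  let ?g = "Q *v w - b"
  have ge: "quad_obj Q b w + ?g \<bullet> (v - w) \<le> quad_obj Q b v" for v
    using quad_obj_expansion[of Q b v w] assms(1) by (simp add: pos_semidef_matrix_def)
  have "quad_obj Q b w = quad_obj Q b w + ?g \<bullet> ((1 - u) *\<^sub>R (x - w) + u *\<^sub>R (z - w))"
    by (simp add: w_def algebra_simps)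
  also have "\<dots> = (1 - u) * (quad_obj Q b w + ?g \<bullet> (x - w)) + u * (quad_obj Q b w + ?g \<bullet> (z - w))"
    unfolding inner_add_right inner_scaleR_right by (simp add: algebra_simps)
  also have "\<dots> \<le> (1 - u) * quad_obj Q b x + u * quad_obj Q b z"
    using assms(2,3) by (intro add_mono mult_left_mono ge) auto
  finally show ?thesis by (simp add: w_def)
qed

section \<open>The proximal step and the energy of one step\<close>

text \<open>The proximal objective is quadratic with Hessian \<open>Q + S\<close>, so its expansion
  about the minimiser has no linear term.\<close>

lemma prox_step_identity:
  fixes Q S :: "real^'n^'n" and b y z :: "real^'n"
  assumes Q: "pos_def_matrix Q" and S: "pos_semidef_matrix S"
  defines "p \<equiv> prox_step Q b S y"
  shows "quad_obj Q b z + 1/2 * (matrix_seminorm S (z - y))\<^sup>2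
    = quad_obj Q b p + 1/2 * (matrix_seminorm S (p - y))\<^sup>2
      + 1/2 * ((z - p) \<bullet> (Q *v (z - p))) + 1/2 * (matrix_seminorm S (z - p))\<^sup>2"
proof -
  let ?g = "\<lambda>x. quad_obj Q b x + 1/2 * (matrix_seminorm S (x - y))\<^sup>2"
  have sym: "transpose Q = Q" "transpose S = S"
    using Q S by (auto simp: pos_def_matrix_def pos_semidef_matrix_def)
  obtain q where q: "(Q + S) *v q = b + S *v y"
    using pos_def_matrix_solvable[OF pos_def_matrix_add[OF Q S]] .
  have stationary: "Q *v q - b = - (S *v (q - y))"
    using q by (simp add: matrix_vector_mult_add_rdistrib matrix_vector_mult_diff_distrib algebra_simps)
  have *: "?g z = ?g q + 1/2 * ((z - q) \<bullet> (Q *v (z - q))) + 1/2 * (matrix_seminorm S (z - q))\<^sup>2" for z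
    using quadratic_form_add[OF sym(2), of "q - y" "z - q"] quad_obj_expansion[OF sym(1), of b z q]
    unfolding stationary by (simp add: matrix_seminorm_power2[OF S] inner_commute add_divide_distrib)
  have pos: "(z - q) \<bullet> (Q *v (z - q)) \<ge> 0" for z
    using pos_def_imp_semidef[OF Q] by (simp add: pos_semidef_matrix_def)
  have "?g q \<le> ?g z" for z
    using *[of z] pos[of z] zero_le_power2[of "matrix_seminorm S (z - q)"] by linarith
  then have "is_arg_min ?g (\<lambda>_. True) q" by (simp add: is_arg_min_linorder)
  \<comment> \<open>\<open>ARG_MIN\<close> picks some minimiser, and \<open>q\<close> shows that one
    exists; definiteness of \<open>Q\<close> then forces \<open>p = q\<close>.\<close>
  then have "is_arg_min ?g (\<lambda>_. True) p"
    unfolding p_def prox_step_def arg_min_def by (rule someI)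
  then have "?g p \<le> ?g q" by (simp add: is_arg_min_linorder)
  then have "(p - q) \<bullet> (Q *v (p - q)) \<le> 0"
    using *[of p] zero_le_power2[of "matrix_seminorm S (p - q)"] by linarith
  then have "p = q"
    using Q unfolding pos_def_matrix_def by (metis linorder_not_less right_minus_eq)
  then show ?thesis using *[of z] by simp
qed

lemma prox_step_le:
  fixes Q S :: "real^'n^'n"
  assumes "pos_def_matrix Q" "pos_semidef_matrix S"
  shows "quad_obj Q b (prox_step Q b S y) + 1/2 * (matrix_seminorm S (z - prox_step Q b S y))\<^sup>2
    \<le> quad_obj Q b z + 1/2 * (matrix_seminorm S (z - y))\<^sup>2"
proof -
  let ?p = "prox_step Q b S y"
  have "(z - ?p) \<bullet> (Q *v (z - ?p)) \<ge> 0"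
    using pos_def_imp_semidef[OF assms(1)] by (simp add: pos_semidef_matrix_def)
  then show ?thesis
    using prox_step_identity[OF assms, of b z y] zero_le_power2[of "matrix_seminorm S (?p - y)"]
    by linarith
qed

text \<open>The proximal inequality at the convex combination \<open>(1 - 1/a) x + (1/a) z\<close>, scaled by \<open>a\<^sup>2\<close>.\<close>

lemma accelerated_energy_decrease:
  fixes Q S :: "real^'n^'n" and b x y z :: "real^'n" and a :: real
  assumes Q: "pos_def_matrix Q" and S: "pos_semidef_matrix S" and a: "a \<ge> 1"
  defines "p \<equiv> prox_step Q b S y"
  shows "a\<^sup>2 * (quad_obj Q b p - quad_obj Q b z)
      + 1/2 * (matrix_seminorm S (x + a *\<^sub>R (p - x) - z))\<^sup>2
    \<le> (a\<^sup>2 - a) * (quad_obj Q b x - quad_obj Q b z)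
      + 1/2 * (matrix_seminorm S (x + a *\<^sub>R (y - x) - z))\<^sup>2"
proof -
  define w where "w = (1 - 1/a) *\<^sub>R x + (1/a) *\<^sub>R z"
  \<comment> \<open>Needed for \<open>v = p\<close> and \<open>v = y\<close>: scaling by
    \<open>a\<close> turns the distance to \<open>w\<close> into that of an extrapolated point to
    \<open>z\<close>.\<close>
  have norm_w: "a\<^sup>2 * (matrix_seminorm S (w - v))\<^sup>2 = (matrix_seminorm S (x + a *\<^sub>R (v - x) - z))\<^sup>2" for v
  proof -
    have "x + a *\<^sub>R (v - x) - z = (- a) *\<^sub>R (w - v)"
      using a by (simp add: w_def algebra_simps)
    then show ?thesis by (simp only: matrix_seminorm_scaleR power_mult_distrib) simp
  qed
  have "quad_obj Q b w \<le> (1 - 1/a) * quad_obj Q b x + 1/a * quad_obj Q b z"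
    unfolding w_def using a by (intro quad_obj_convex pos_def_imp_semidef[OF Q]) auto
  then have "a\<^sup>2 * quad_obj Q b w \<le> a\<^sup>2 * ((1 - 1/a) * quad_obj Q b x + 1/a * quad_obj Q b z)"
    by (intro mult_left_mono) auto
  also have "\<dots> = (a\<^sup>2 - a) * quad_obj Q b x + a * quad_obj Q b z"
    using a by (simp add: field_simps power2_eq_square)
  finally have conv: "a\<^sup>2 * quad_obj Q b w \<le> (a\<^sup>2 - a) * quad_obj Q b x + a * quad_obj Q b z" .
  have "a\<^sup>2 * (quad_obj Q b p + 1/2 * (matrix_seminorm S (w - p))\<^sup>2)
      \<le> a\<^sup>2 * (quad_obj Q b w + 1/2 * (matrix_seminorm S (w - y))\<^sup>2)"
    unfolding p_def by (intro mult_left_mono prox_step_le Q S) auto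
  then show ?thesis using conv norm_w[of p] norm_w[of y] by (simp add: algebra_simps)
qed

section \<open>Momentum parameter and logarithmic rate\<close>

text \<open>The identity lets the energies of successive steps chain; the increment 1/2 makes the
  parameter grow linearly, hence the quadratic rate.\<close>

lemma momentum_parameter:
  fixes a :: real
  assumes "a \<ge> 0"
  defines "a' \<equiv> (1 + sqrt (1 + 4 * a\<^sup>2)) / 2"
  shows "a'\<^sup>2 - a' = a\<^sup>2" "a' \<ge> a + 1/2" "a' \<ge> 1"
proof -
  have "(sqrt (1 + 4 * a\<^sup>2))\<^sup>2 = 1 + 4 * a\<^sup>2" by simp
  then show "a'\<^sup>2 - a' = a\<^sup>2"
    unfolding a'_def by (simp add: power2_eq_square field_simps)
  have "2 * a \<le> sqrt (1 + 4 * a\<^sup>2)" by (rule real_le_rsqrt) (simp add: power_mult_distrib)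
  then show "a' \<ge> a + 1/2" unfolding a'_def by simp
  have "1 \<le> sqrt (1 + 4 * a\<^sup>2)" by simp
  then show "a' \<ge> 1" unfolding a'_def by simp
qed

text \<open>Among \<open>m\<close> stages of total length about \<open>t\<close>, one has length \<open>M\<close> at least \<open>t/m - 1\<close>.\<close>

lemma log_rate:
  fixes d R :: real
  assumes d: "d \<le> 2 * R\<^sup>2 / (real M + 1)\<^sup>2" and t: "t \<le> m * (M + 1)" and m: "2 ^ m \<le> t" "m > 0"
  shows "d \<le> 2 * R\<^sup>2 * (log 2 (real t))\<^sup>2 / (real t)\<^sup>2"
proof -
  have "t > 0" using m(1) by (metis gr_zeroI le_zero_eq power_not_zero zero_neq_numeral)
  have "2 ^ m \<le> real t" using m(1) by (metis of_nat_le_iff of_nat_numeral of_nat_power)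
  then have "real m \<le> log 2 (real t)" using \<open>t > 0\<close> by (simp add: le_log_iff powr_realpow)
  define D where "D = real M + 1"
  have "D > 0" by (simp add: D_def)
  from \<open>real m \<le> log 2 (real t)\<close> have "real t \<le> log 2 (real t) * D"
    unfolding D_def
    using t by (smt (verit) mult_right_mono of_nat_0_le_iff of_nat_1 of_nat_add of_nat_mono of_nat_mult)
  then have "(real t)\<^sup>2 \<le> (log 2 (real t) * D)\<^sup>2" by (intro power_mono) auto
  then have "1 / D\<^sup>2 \<le> (log 2 (real t))\<^sup>2 / (real t)\<^sup>2"
    using \<open>t > 0\<close> \<open>D > 0\<close> by (simp add: field_simps)
  then have "2 * R\<^sup>2 * (1 / D\<^sup>2) \<le> 2 * R\<^sup>2 * ((log 2 (real t))\<^sup>2 / (real t)\<^sup>2)"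
    by (intro mult_left_mono) auto
  then show ?thesis using d by (simp add: D_def)
qed

text \<open>\<open>T\<close> is the total length of the \<open>l\<close> completed stages, \<open>N\<close> the length of the longest one,
  \<open>v\<close> the starting point of the current stage and \<open>k\<close> the number of steps taken in it.
  The extrapolated point satisfies \<open>x + \<alpha> (y - x) = x\<^sup>k\<^sup>-\<^sup>1 + \<alpha>\<^sub>k (x\<^sup>k - x\<^sup>k\<^sup>-\<^sup>1)\<close>, and
  \<open>\<alpha>\<^sup>2 - \<alpha> = \<alpha>\<^sub>k\<^sup>2\<close>, so the inequality with right-hand side \<open>R\<^sup>2 / 2\<close>
  is the energy bound.\<close>

definition run_invariant ::
    "real^'n^'n \<Rightarrow> real^'n \<Rightarrow> real^'n^'n \<Rightarrow> real^'n \<Rightarrow> real^'n \<Rightarrow> real \<Rightarrow> nat \<Rightarrow>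
      nat \<Rightarrow> nat \<Rightarrow> nat \<Rightarrow> nat \<Rightarrow> real^'n \<Rightarrow> (real^'n) accel_state \<Rightarrow> bool" where
  "run_invariant Q b S x0 xs R K0 l T N k v s \<longleftrightarrow>
     window s = 2 ^ l * K0 \<and>
     (2 ^ l - 1) * K0 \<le> T \<and> T \<le> l * N \<and>
     quad_obj Q b v \<le> quad_obj Q b x0 \<and>
     (N > 0 \<longrightarrow> quad_obj Q b v - quad_obj Q b xs \<le> 2 * R\<^sup>2 / (real N + 1)\<^sup>2) \<and>
     quad_obj Q b (iter s) + 1/2 * (matrix_seminorm S (extrap s - iter s))\<^sup>2 \<le> quad_obj Q b v \<and>
     ((alpha s)\<^sup>2 - alpha s) * (quad_obj Q b (iter s) - quad_obj Q b xs)
       + 1/2 * (matrix_seminorm S (iter s + alpha s *\<^sub>R (extrap s - iter s) - xs))\<^sup>2 \<le> 1/2 * R\<^sup>2 \<and>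
     alpha s \<ge> 1 + real k / 2 \<and> (k > 0 \<longrightarrow> (alpha s)\<^sup>2 - alpha s \<ge> (real k + 1)\<^sup>2 / 4)"

section \<open>Preservation of the invariant and the resulting rate\<close>

context
  fixes Q S :: "real^'n^'n" and b x0 xs :: "real^'n" and R :: real and K0 :: nat
  assumes Q: "pos_def_matrix Q" and S: "pos_semidef_matrix S"
    and min: "\<And>x. quad_obj Q b xs \<le> quad_obj Q b x"
    and R: "\<And>x. quad_obj Q b x \<le> quad_obj Q b x0 \<Longrightarrow> matrix_seminorm S (x - xs) \<le> R"
    and K0: "K0 \<ge> 2"
begin

lemma run_invariant_iter_le:
  assumes "run_invariant Q b S x0 xs R K0 l T N k v s"
  shows "quad_obj Q b (iter s) \<le> quad_obj Q b v"
  using assms zero_le_power2[of "matrix_seminorm S (extrap s - iter s)"]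
  unfolding run_invariant_def by linarith

text \<open>The energy bound is divided by its coefficient, for which the invariant gives a positive
  lower bound only after the first step.\<close>

lemma run_invariant_rate:
  assumes inv: "run_invariant Q b S x0 xs R K0 l T N k v s" and k: "k > 0"
  shows "quad_obj Q b (iter s) - quad_obj Q b xs \<le> 2 * R\<^sup>2 / (real k + 1)\<^sup>2"
proof -
  let ?d = "quad_obj Q b (iter s) - quad_obj Q b xs"
  have "(real k + 1)\<^sup>2 / 4 * ?d \<le> ((alpha s)\<^sup>2 - alpha s) * ?d"
    using inv k min[of "iter s"] unfolding run_invariant_def by (intro mult_right_mono) auto
  also have "\<dots> \<le> 1/2 * R\<^sup>2"
    using inv zero_le_power2[of "matrix_seminorm S (iter s + alpha s *\<^sub>R (extrap s - iter s) - xs)"]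
    unfolding run_invariant_def by linarith
  finally show ?thesis by (simp add: field_simps)
qed

text \<open>With \<open>alpha s = 1\<close> and no extrapolation the energy is half the squared
  distance to \<open>xs\<close>, and the start lies in the level set.\<close>

lemma run_invariant_start:
  assumes "window s = 2 ^ l * K0" "(2 ^ l - 1) * K0 \<le> T" "T \<le> l * N"
    and le: "quad_obj Q b (iter s) \<le> quad_obj Q b x0"
    and "N > 0 \<Longrightarrow> quad_obj Q b (iter s) - quad_obj Q b xs \<le> 2 * R\<^sup>2 / (real N + 1)\<^sup>2"
    and "extrap s = iter s" "alpha s = 1"
  shows "run_invariant Q b S x0 xs R K0 l T N 0 (iter s) s"
proof -
  have "(matrix_seminorm S (iter s - xs))\<^sup>2 \<le> R\<^sup>2"
    using R[OF le] matrix_seminorm_nonneg[OF S] by (intro power_mono)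
  moreover have "matrix_seminorm S (0::real^'n) = 0" by (simp add: matrix_seminorm_def)
  ultimately show ?thesis using assms by (simp add: run_invariant_def)
qed

lemma run_invariant_restart:
  assumes inv: "run_invariant Q b S x0 xs R K0 l T N k v s"
    and test: "restart_test Q b S t s" and t: "t = Suc (last_restart s + k)"
  shows "run_invariant Q b S x0 xs R K0 (Suc l) (T + k) (max N k) 0 (iter s) (accel_step Q b S t s)"
proof -
  let ?s = "accel_step Q b S t s"
  have s: "?s = \<lparr>iter = iter s, extrap = iter s, alpha = 1, last_restart = t, window = 2 * window s\<rparr>"
    using test by (simp add: accel_step_def)
  have w: "window s = 2 ^ l * K0" and T: "(2 ^ l - 1) * K0 \<le> T" "T \<le> l * N"
    using inv by (auto simp: run_invariant_def)
  \<comment> \<open>By the off-by-one in \<open>t\<close>, the restart test says that the completed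
    stage has at least \<open>window s\<close> steps.\<close>
  have k: "2 ^ l * K0 \<le> k" using test t w by (simp add: restart_test_def)
  with K0 have "k > 0" by (metis bot_nat_0.not_eq_extremum le_zero_eq mult_is_0 not_numeral_le_zero power_not_zero zero_neq_numeral)
  have "run_invariant Q b S x0 xs R K0 (Suc l) (T + k) (max N k) 0 (iter ?s) ?s"
  proof (rule run_invariant_start)
    have "(2 ^ Suc l - 1) * K0 = (2 ^ l - 1) * K0 + 2 ^ l * K0"
      by (simp add: algebra_simps flip: diff_mult_distrib)
    then show "(2 ^ Suc l - 1) * K0 \<le> T + k" using T(1) k by linarith
    have "l * N \<le> l * max N k" "k \<le> max N k" by simp_all
    then show "T + k \<le> Suc l * max N k" using T(2) unfolding mult_Suc by linarith
    show "quad_obj Q b (iter ?s) \<le> quad_obj Q b x0"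
      using run_invariant_iter_le[OF inv] inv s by (simp add: run_invariant_def)
    show "quad_obj Q b (iter ?s) - quad_obj Q b xs \<le> 2 * R\<^sup>2 / (real (max N k) + 1)\<^sup>2"
    proof (cases "N \<le> k")
      case True
      then show ?thesis using run_invariant_rate[OF inv \<open>k > 0\<close>] s by (simp add: max_absorb2)
    next
      case False
      then show ?thesis using run_invariant_iter_le[OF inv] inv s by (simp add: run_invariant_def)
    qed
  qed (use s w in auto)
  then show ?thesis using s by simp
qed

lemma run_invariant_step:
  assumes inv: "run_invariant Q b S x0 xs R K0 l T N k v s" and test: "\<not> restart_test Q b S t s"
  shows "run_invariant Q b S x0 xs R K0 l T N (Suc k) v (accel_step Q b S t s)"
proof -
  let ?f = "quad_obj Q b" and ?n = "matrix_seminorm S"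
  define a where "a = alpha s"
  define a' where "a' = (1 + sqrt (1 + 4 * a\<^sup>2)) / 2"
  define p where "p = prox_step Q b S (extrap s)"
  define c where "c = (a - 1) / a'"
  have s: "accel_step Q b S t s = \<lparr>iter = p, extrap = (1 + c) *\<^sub>R p - c *\<^sub>R iter s, alpha = a',
      last_restart = last_restart s, window = window s\<rparr>"
    using test by (simp add: accel_step_def Let_def a_def a'_def p_def c_def)
  have a: "a \<ge> 1 + real k / 2" using inv by (simp add: run_invariant_def a_def)
  then have a1: "a \<ge> 1" "a \<ge> 0" by auto
  note a' = momentum_parameter[OF a1(2), folded a'_def]
  have c: "0 \<le> c" "c \<le> 1" using a1 a' by (auto simp: c_def)
  have extrap: "(1 + c) *\<^sub>R p - c *\<^sub>R iter s - p = c *\<^sub>R (p - iter s)"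
    by (simp add: algebra_simps)
  \<comment> \<open>The new extrapolation is at most as long as the step just taken, whose length
    the proximal inequality at \<open>iter s\<close> controls.\<close>
  have "?n (c *\<^sub>R (p - iter s)) \<le> ?n (p - iter s)"
    using c matrix_seminorm_nonneg[OF S] by (simp add: matrix_seminorm_scaleR mult_left_le_one_le)
  then have "(?n (c *\<^sub>R (p - iter s)))\<^sup>2 \<le> (?n (p - iter s))\<^sup>2"
    using matrix_seminorm_nonneg[OF S] by (intro power_mono)
  then have descent: "?f p + 1/2 * (?n (c *\<^sub>R (p - iter s)))\<^sup>2
      \<le> ?f (iter s) + 1/2 * (?n (extrap s - iter s))\<^sup>2"
    using prox_step_le[OF Q S, of b "extrap s" "iter s", folded p_def]
    by (simp add: matrix_seminorm_minus_commute[of S "iter s"])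
  \<comment> \<open>This is what the factor \<open>c\<close> is chosen for: the new energy is
    measured at the point that the energy decrease bounds.\<close>
  have "p + a' *\<^sub>R (c *\<^sub>R (p - iter s)) = iter s + a *\<^sub>R (p - iter s)"
  proof -
    have "a' * c = a - 1" using a' by (simp add: c_def)
    then show ?thesis by (simp add: scaleR_left_diff_distrib)
  qed
  then have energy: "(a'\<^sup>2 - a') * (?f p - ?f xs) + 1/2 * (?n (p + a' *\<^sub>R (c *\<^sub>R (p - iter s)) - xs))\<^sup>2
      \<le> 1/2 * R\<^sup>2"
    using accelerated_energy_decrease[OF Q S a1(1), of b "extrap s" xs "iter s"] inv
    by (simp add: run_invariant_def a_def[symmetric] p_def[symmetric] a'(1))
  have "((real k + 2) / 2)\<^sup>2 \<le> a\<^sup>2" using a by (intro power_mono) auto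
  then have growth: "(real (Suc k) + 1)\<^sup>2 / 4 \<le> a'\<^sup>2 - a'" using a'(1) by (simp add: power_divide add.commute)
  have "1 + real (Suc k) / 2 \<le> a'" using a a'(2) by (simp add: add_divide_distrib)
  then show ?thesis
    using inv descent energy growth unfolding run_invariant_def s
    by (simp add: extrap)
qed

lemma run_invariant_holds:
  "\<exists>l T N k v. run_invariant Q b S x0 xs R K0 l T N k v (accel_run Q b S x0 K0 r) \<and>
    r = last_restart (accel_run Q b S x0 K0 r) + k \<and>
    nonrestart_count (restart_at Q b S x0 K0) r = T + k"
proof (induction r)
  case 0
  show ?case
    by (intro exI[of _ 0] exI[of _ "iter (accel_run Q b S x0 K0 0)"] conjI run_invariant_start) auto
next
  case (Suc r)
  let ?s = "accel_run Q b S x0 K0 r"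
  obtain l T N k v where inv: "run_invariant Q b S x0 xs R K0 l T N k v ?s"
    and r: "r = last_restart ?s + k"
    and count: "nonrestart_count (restart_at Q b S x0 K0) r = T + k"
    using Suc by blast
  show ?case
  proof (cases "restart_test Q b S (Suc r) ?s")
    case True
    have "run_invariant Q b S x0 xs R K0 (Suc l) (T + k) (max N k) 0 (iter ?s) (accel_run Q b S x0 K0 (Suc r))"
      using run_invariant_restart[OF inv True] r by simp
    moreover have "last_restart (accel_run Q b S x0 K0 (Suc r)) = Suc r"
      using True by (simp add: accel_step_def)
    moreover have "nonrestart_count (restart_at Q b S x0 K0) (Suc r) = T + k"
      using True count by (simp add: restart_at_def)
    ultimately show ?thesis by (metis add_0_right)
  next
    case False
    have "run_invariant Q b S x0 xs R K0 l T N (Suc k) v (accel_run Q b S x0 K0 (Suc r))"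
      using run_invariant_step[OF inv False] by simp
    moreover have "Suc r = last_restart (accel_run Q b S x0 K0 (Suc r)) + Suc k"
      using False r by (simp add: accel_step_def Let_def)
    moreover have "nonrestart_count (restart_at Q b S x0 K0) (Suc r) = T + Suc k"
      using False count by (simp add: restart_at_def)
    ultimately show ?thesis by metis
  qed
qed

text \<open>The current stage counts as one of the \<open>m\<close> stages of
  \<open>log_rate\<close> only if it has at least two steps.\<close>

lemma run_invariant_log_rate:
  assumes inv: "run_invariant Q b S x0 xs R K0 l T N k v s" and t: "T + k \<ge> 2"
  shows "quad_obj Q b (iter s) - quad_obj Q b xs
    \<le> 2 * R\<^sup>2 * (log 2 (real (T + k)))\<^sup>2 / (real (T + k))\<^sup>2"
proof -
  let ?d = "quad_obj Q b (iter s) - quad_obj Q b xs"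
  have T: "(2 ^ l - 1) * K0 \<le> T" "T \<le> l * N" using inv by (auto simp: run_invariant_def)
  have "(2 ^ l - 1) * 2 \<le> (2 ^ l - 1) * K0" using K0 by (rule mult_le_mono2)
  with T(1) have T2: "2 ^ l + 2 ^ l \<le> T + 2" by (simp add: diff_mult_distrib)
  have N: "?d \<le> 2 * R\<^sup>2 / (real N + 1)\<^sup>2" if "N > 0"
    using run_invariant_iter_le[OF inv] inv that by (simp add: run_invariant_def)
  show ?thesis
  proof (cases "k \<ge> 2")
    case True
    have "?d \<le> 2 * R\<^sup>2 / (real (max N k) + 1)\<^sup>2"
      using N run_invariant_rate[OF inv] True by (cases "N \<le> k") (auto simp: max_def)
    moreover have "l * N \<le> l * (max N k + 1)" "k \<le> max N k"
      by (rule mult_le_mono2) simp_all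
    then have "T + k \<le> Suc l * (max N k + 1)" using T(2) unfolding mult_Suc by linarith
    \<comment> \<open>Two steps make up for the 2 in \<open>T2\<close>.\<close>
    moreover have "2 ^ Suc l \<le> T + k" using T2 True by simp
    ultimately show ?thesis by (rule log_rate) simp
  next
    case False
    then have "T > 0" using t by simp
    then have pos: "l > 0" "N > 0" using T(2) by (auto intro: gr0I)
    have "(2::nat) ^ 1 \<le> 2 ^ l" using pos by (intro power_increasing) auto
    then have "2 ^ l \<le> T + k" using T2 by simp
    \<comment> \<open>A single uncounted step fits into the slack \<open>l\<close> of
      \<open>l * (N + 1)\<close>.\<close>
    moreover have "T + k \<le> l * (N + 1)" using T(2) False pos by (simp add: algebra_simps)
    ultimately show ?thesis using pos by (intro log_rate[OF N])
  qed
qed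

end

theorem theorem2p5:
  fixes Q S :: "real^'n^'n" and b x0 xs :: "real^'n" and R :: real and K0 :: nat
  assumes "pos_def_matrix Q"
    and "pos_semidef_matrix S"
    and "is_arg_min (quad_obj Q b) (\<lambda>_. True) xs"
    and "R > 0"
    and "R \<ge> (SUP x\<in>{x. quad_obj Q b x \<le> quad_obj Q b x0}. matrix_seminorm S (x - xs))"
    and "K0 \<ge> 2"
  shows "\<forall>t\<ge>2. quad_obj Q b (restarted_seq Q b S x0 K0 t) - quad_obj Q b xs
           \<le> 2 * R\<^sup>2 * (log 2 (real t))\<^sup>2 / (real t)\<^sup>2"
proof (intro allI impI)
  fix t :: nat
  assume t: "t \<ge> 2"
  let ?P = "restart_at Q b S x0 K0"
  have min: "quad_obj Q b xs \<le> quad_obj Q b x" for x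
    using assms(3) by (simp add: is_arg_min_linorder)
  have R: "matrix_seminorm S (x - xs) \<le> R" if "quad_obj Q b x \<le> quad_obj Q b x0" for x
    \<comment> \<open>A real \<open>SUP\<close> bounds its members only if the set is bounded above,
      which definiteness of \<open>Q\<close> ensures.\<close>
    by (rule order_trans[OF cSUP_upper[OF _ matrix_seminorm_level_bdd[OF assms(1)]] assms(5)])
      (simp add: that)
  have K0: "K0 \<ge> 1" using assms(6) by simp
  \<comment> \<open>A raw iteration \<open>r\<close> at which the counter without restarts equals
    \<open>t\<close>.\<close>
  obtain r where r: "nonrestart_count ?P r = t" using nonrestart_count_surj[OF K0] by blast
  obtain l k where lk: "stage_index ?P l k" "r = the_enat (restart_time ?P l) + k"
    using stage_index_exists by blast
  have "restarted_seq Q b S x0 K0 t = stage_iterate Q b S x0 K0 l k"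
    using restarted_seq_eq[OF K0 lk(1)] stage_index_count[OF lk(1)] lk(2) r by simp
  then have seq: "restarted_seq Q b S x0 K0 t = iter (accel_run Q b S x0 K0 r)"
    by (simp add: stage_iterate_def lk(2))
  obtain l T N k v where "run_invariant Q b S x0 xs R K0 l T N k v (accel_run Q b S x0 K0 r)"
    and "t = T + k"
    using run_invariant_holds[OF assms(1,2) min R assms(6), where ?x0.0 = x0 and r = r] r by auto
  then show "quad_obj Q b (restarted_seq Q b S x0 K0 t) - quad_obj Q b xs
      \<le> 2 * R\<^sup>2 * (log 2 (real t))\<^sup>2 / (real t)\<^sup>2"
    using run_invariant_log_rate[OF assms(1,2) min R assms(6)] t seq by simp
qed

end
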